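(* The margin of $\Omega_{n,d}\subseteq(\mathbb{R}^n)^d$ is bounded as follows. (a) If $n=2$ and $d\geq 3$, then $\gamma(\Omega_{2,d})\leq 2^{-\frac d2+1}$. (b) If $n\geq 3$ and $d=3$, then $\gamma(\Omega_{n,3})\leq 2^{-n+1}$. (c) If $n\geq 3$ and $d=6r-3$ for some integer $r\geq 2$, then $$\gamma(\Omega_{n,d})\leq\frac{\sqrt6}{(n-1)\sqrt r}\,2^{-r(n-1)+1}\leq 2^{-r(n-1)+1}=2^{-\frac{(d+3)(n-1)}{6}+1}.$$
   Context: For $i\in[n]$ let $\varepsilon_i:=e_i-\frac1n\mathbb{1}_n\in\mathbb{R}^n$, with $e_i$ the standard unit vector and $\mathbb{1}_n$ the all-ones vector. Let $\Omega_{n,d}:=\{(\varepsilon_{i_1},\dots,\varepsilon_{i_d}):i_1,\dots,i_d\in[n]\}\subseteq(\mathbb{R}^n)^d$. For a finite set $\Omega\subseteq\mathbb{R}^m$, its margin is $\gamma(\Omega):=\min\{\operatorname{dist}(0,\operatorname{conv}(S)): S\subseteq\Omega,\ 0\notin\operatorname{conv}(S)\}$. *)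

theory Defs
  imports "HOL-Analysis.Analysis"
begin

definition eps_vec :: "'n::finite \<Rightarrow> real ^ 'n" where
  "eps_vec i = axis i 1 - (1 / real CARD('n)) *\<^sub>R vec 1"

text \<open>Here n is \<open>CARD('n)\<close> and d is \<open>CARD('d)\<close>; the norm on \<open>real ^ 'n ^ 'd\<close> is the
  Euclidean norm of the concatenated vector, i.e. that of a point of dimension n d.\<close>

definition Omega :: "(real ^ 'n::finite ^ 'd::finite) set" where
  "Omega = {(\<chi> j. eps_vec (i j)) | i :: 'd \<Rightarrow> 'n. True}"

text \<open>The empty set is excluded because \<open>infdist x {} = 0\<close>, whereas its distance
  to the origin should be read as infinite and so never attains the minimum.
  For finite \<open>W\<close> the minimum is over a finite set, nonempty as soon as \<open>W\<close>
  contains a nonzero vector.\<close>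

definition margin :: "'a::euclidean_space set \<Rightarrow> real" where
  "margin W = Min {infdist 0 (convex hull S) | S. S \<subseteq> W \<and> S \<noteq> {} \<and> 0 \<notin> convex hull S}"

end

theory Submission imports Defs begin

text \<open>
  A family of words over n letters, with weights summing to 1, gives a point of the convex hull of
  the corresponding vectors, and that point is 0 iff every position has a uniform letter
  distribution (marginal). So one needs a family that admits no weights with uniform marginals, but
  weights whose marginals are uniform up to an exponentially small error.

  For n = 2, equality of the marginals of two positions is one linear equation in the weights, and
  m such pairs express \<open>P k = (\<Sum>i<k. P i)\<close> for k = 1, ..., m: the masses double m - 1 times. One
  or two further positions then detect the smallest mass \<open>P 0\<close>.

  For d = 3 and an alphabet of size N, the triples (s,0,s), (s,s,0), (s-1,s,s) with 0 < s < N work: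
  uniform marginals force the weight of (s-1,s,s) to differ from 1/N by twice as much at s + 1 as at
  s, starting from 0 at s = 1, whereas at s = N the weight has to be 0. Lowering the marginals at
  the letter 0 by a fraction \<open>2 ^ -(N - 1)\<close> removes the contradiction.

  For d = 3(2r-1), take N = rn and replace each of the three letters by 2r-1 letters of a size n
  alphabet, using maps from the N letters onto the n letters with all fibres of size r, chosen such
  that only the uniform distribution on the N letters has uniform images under all of them.
\<close>

section \<open>From weighted families of words to bounds on the margin\<close>

definition marginal :: "'t set \<Rightarrow> ('t \<Rightarrow> 'e \<Rightarrow> 'l) \<Rightarrow> ('t \<Rightarrow> real) \<Rightarrow> 'e \<Rightarrow> 'l \<Rightarrow> real" where
  "marginal T word u j i = (\<Sum>t\<in>T. if word t j = i then u t else 0)"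

text \<open>The weighted sums form a convex set containing every \<open>v t\<close>. Weights sit on
  the indices, so distinct indices may give the same point.\<close>

lemma convex_hull_image_imp_weights:
  fixes v :: "'t \<Rightarrow> 'a::real_vector"
  assumes "finite T" and "x \<in> convex hull (v ` T)"
  obtains u where "\<And>t. t \<in> T \<Longrightarrow> 0 \<le> u t" and "sum u T = 1" and "(\<Sum>t\<in>T. u t *\<^sub>R v t) = x"
proof -
  let ?C = "{(\<Sum>t\<in>T. u t *\<^sub>R v t) | u. (\<forall>t\<in>T. 0 \<le> u t) \<and> sum u T = 1}"
  have "convex ?C"
  proof (rule convexI)
    fix y z and a b :: real
    assume y: "y \<in> ?C" and z: "z \<in> ?C" and ab: "0 \<le> a" "0 \<le> b" "a + b = 1"
    from y obtain p where p: "\<forall>t\<in>T. 0 \<le> p t" "sum p T = 1" "y = (\<Sum>t\<in>T. p t *\<^sub>R v t)" by auto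
    from z obtain q where q: "\<forall>t\<in>T. 0 \<le> q t" "sum q T = 1" "z = (\<Sum>t\<in>T. q t *\<^sub>R v t)" by auto
    have "a *\<^sub>R y + b *\<^sub>R z = (\<Sum>t\<in>T. (a * p t + b * q t) *\<^sub>R v t)"
      by (simp add: p(3) q(3) scaleR_sum_right sum.distrib scaleR_add_left)
    moreover have "(\<Sum>t\<in>T. a * p t + b * q t) = 1"
      using p(2) q(2) ab(3) by (simp add: sum.distrib flip: sum_distrib_left)
    ultimately show "a *\<^sub>R y + b *\<^sub>R z \<in> ?C"
      using p(1) q(1) ab by (intro CollectI exI[of _ "\<lambda>t. a * p t + b * q t"]) auto
  qed
  moreover have "v ` T \<subseteq> ?C"
  proof
    fix y assume "y \<in> v ` T"
    then obtain s where s: "s \<in> T" "y = v s" by auto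
    have "(\<Sum>t\<in>T. (if t = s then 1 else 0) *\<^sub>R v t) = (\<Sum>t\<in>T. if t = s then v t else 0)"
      by (rule sum.cong) auto
    then have "y = (\<Sum>t\<in>T. (if t = s then 1 else 0) *\<^sub>R v t)"
      using s assms(1) by simp
    then show "y \<in> ?C"
      using s assms(1) by (intro CollectI exI[of _ "\<lambda>t. if t = s then 1 else 0"]) auto
  qed
  ultimately have "convex hull (v ` T) \<subseteq> ?C"
    by (rule hull_minimal[rotated])
  with assms(2) show ?thesis using that by blast
qed

lemma margin_le_norm:
  fixes W :: "'a::euclidean_space set"
  assumes "finite W" and "S \<subseteq> W" and "0 \<notin> convex hull S" and "x \<in> convex hull S"
  shows "margin W \<le> norm x"
proof -
  let ?M = "{infdist 0 (convex hull S) | S. S \<subseteq> W \<and> S \<noteq> {} \<and> 0 \<notin> convex hull S}"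
  have "?M \<subseteq> (\<lambda>S. infdist 0 (convex hull S)) ` Pow W" by auto
  then have "finite ?M" using assms(1) by (meson finite_Pow_iff finite_imageI finite_subset)
  moreover have "infdist 0 (convex hull S) \<in> ?M" using assms by auto
  ultimately have "margin W \<le> infdist 0 (convex hull S)" unfolding margin_def by (rule Min_le)
  also have "\<dots> \<le> dist 0 x" using assms(4) by (rule infdist_le)
  finally show ?thesis by simp
qed

lemma finite_Omega: "finite (Omega :: (real ^ 'n::finite ^ 'd::finite) set)"
proof -
  have "(Omega :: (real ^ 'n ^ 'd) set) = range (\<lambda>i :: 'd \<Rightarrow> 'n. \<chi> j. eps_vec (i j))"
    by (auto simp: Omega_def)
  then show ?thesis by (metis finite finite_imageI)
qed

lemma norm_power2_vec_vec:
  fixes x :: "real ^ 'n::finite ^ 'd::finite"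
  shows "(norm x)\<^sup>2 = (\<Sum>j\<in>UNIV. \<Sum>i\<in>UNIV. (x $ j $ i)\<^sup>2)"
  by (simp add: norm_vec_def L2_set_def sum_nonneg)

text \<open>Each coordinate of a weighted sum of the vectors is a marginal minus 1/n. Hence a zero
  sum means uniform marginals, and the squared norm is the sum of squared deviations. Positions and
  letters are carried over to \<open>'d\<close> and \<open>'n\<close> by bijections, so that
  constructions can use pairs and naturals.\<close>

lemma margin_Omega_le:
  fixes word :: "'t \<Rightarrow> 'e \<Rightarrow> 'l" and w :: "'t \<Rightarrow> real"
  assumes T: "finite T"
    and D: "card D = CARD('d::finite)"
    and L: "card L = CARD('n::finite)"
    and word: "\<And>t j. t \<in> T \<Longrightarrow> j \<in> D \<Longrightarrow> word t j \<in> L"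
    and no_uniform: "\<And>u. \<lbrakk>\<And>t. t \<in> T \<Longrightarrow> 0 \<le> u t; sum u T = 1;
          \<And>j i. j \<in> D \<Longrightarrow> i \<in> L \<Longrightarrow> marginal T word u j i = 1 / real CARD('n)\<rbrakk> \<Longrightarrow> False"
    and w: "\<And>t. t \<in> T \<Longrightarrow> 0 \<le> w t" "sum w T = 1"
    and "0 \<le> B"
    and B: "(\<Sum>j\<in>D. \<Sum>i\<in>L. (marginal T word w j i - 1 / real CARD('n))\<^sup>2) \<le> B\<^sup>2"
  shows "margin (Omega :: (real ^ 'n ^ 'd) set) \<le> B"
proof -
  have "finite D" "finite L" using D L by (auto intro: card_ge_0_finite)
  then obtain g h where g: "bij_betw g (UNIV :: 'd set) D" and h: "bij_betw h L (UNIV :: 'n set)"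
    using D L by (metis finite_same_card_bij finite)
  define v :: "'t \<Rightarrow> real ^ 'n ^ 'd" where "v t = (\<chi> j. eps_vec (h (word t (g j))))" for t
  have gD: "g j \<in> D" for j using g by (auto simp: bij_betw_def)
  have comp: "(\<Sum>t\<in>T. u t *\<^sub>R v t) $ j $ h l = marginal T word u (g j) l - 1 / real CARD('n)"
    if u: "sum u T = 1" and l: "l \<in> L" for u j l
  proof -
    have inj: "h l = h (word t (g j)) \<longleftrightarrow> word t (g j) = l" if "t \<in> T" for t
      using h word[OF that gD] l by (auto simp: bij_betw_def inj_on_def)
    have "(\<Sum>t\<in>T. u t *\<^sub>R v t) $ j $ h l = (\<Sum>t\<in>T. u t * (v t $ j $ h l))"
      by simp
    also have "\<dots> = (\<Sum>t\<in>T. (if word t (g j) = l then u t else 0) - u t * (1 / real CARD('n)))"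
      by (rule sum.cong) (simp_all add: inj v_def eps_vec_def axis_def algebra_simps)
    also have "\<dots> = marginal T word u (g j) l - 1 / real CARD('n)"
      using u by (simp add: marginal_def sum_subtractf flip: sum_divide_distrib)
    finally show ?thesis .
  qed
  have "v ` T \<subseteq> Omega" by (auto simp: v_def Omega_def)
  moreover have "0 \<notin> convex hull (v ` T)"
  proof
    assume "0 \<in> convex hull (v ` T)"
    then obtain u where u: "\<And>t. t \<in> T \<Longrightarrow> 0 \<le> u t" "sum u T = 1" "(\<Sum>t\<in>T. u t *\<^sub>R v t) = 0"
      using convex_hull_image_imp_weights[OF T] by metis
    have "marginal T word u j i = 1 / real CARD('n)" if "j \<in> D" "i \<in> L" for j i
    proof -
      obtain j' where "j = g j'" using g \<open>j \<in> D\<close> by (auto simp: bij_betw_def)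
      then show ?thesis using comp[OF u(2) \<open>i \<in> L\<close>, of j'] u(3) by simp
    qed
    with u(1,2) show False by (rule no_uniform)
  qed
  moreover have "(\<Sum>t\<in>T. w t *\<^sub>R v t) \<in> convex hull (v ` T)"
    using T w by (intro convex_sum convex_convex_hull) (auto intro: hull_inc)
  ultimately have "margin (Omega :: (real ^ 'n ^ 'd) set) \<le> norm (\<Sum>t\<in>T. w t *\<^sub>R v t)"
    by (rule margin_le_norm[OF finite_Omega])
  also have "\<dots> \<le> B"
  proof (rule power2_le_imp_le[OF _ \<open>0 \<le> B\<close>])
    have "(norm (\<Sum>t\<in>T. w t *\<^sub>R v t))\<^sup>2
        = (\<Sum>j\<in>UNIV. \<Sum>i\<in>UNIV. ((\<Sum>t\<in>T. w t *\<^sub>R v t) $ j $ i)\<^sup>2)"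
      by (rule norm_power2_vec_vec)
    also have "\<dots> = (\<Sum>j\<in>UNIV. \<Sum>i\<in>L. ((\<Sum>t\<in>T. w t *\<^sub>R v t) $ j $ h i)\<^sup>2)"
      by (intro sum.cong refl sum.reindex_bij_betw[OF h, symmetric])
    also have "\<dots> = (\<Sum>j\<in>UNIV. \<Sum>i\<in>L. (marginal T word w (g j) i - 1 / real CARD('n))\<^sup>2)"
      by (intro sum.cong refl) (simp only: comp[OF w(2)])
    also have "\<dots> = (\<Sum>j\<in>D. \<Sum>i\<in>L. (marginal T word w j i - 1 / real CARD('n))\<^sup>2)"
      by (rule sum.reindex_bij_betw[OF g])
    finally show "(norm (\<Sum>t\<in>T. w t *\<^sub>R v t))\<^sup>2 \<le> B\<^sup>2" using B by simp
  qed
  finally show ?thesis .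
qed

section \<open>The binary alphabet\<close>

lemma sum_doubling:
  assumes "k \<ge> 1"
  shows "(\<Sum>i<k. if i = 0 then 1 else 2 ^ (i - 1)) = (2 ^ (k - 1) :: real)"
  using assms
proof (induction k rule: dec_induct)
  case base
  then show ?case by simp
next
  case (step k)
  then show ?case by (cases k) auto
qed

text \<open>Only the \<open>e\<close> positions (0, a) deviate, by 1/(e 2^m) on each of the two
  letters, so the squared norm is 2 e (1/(e 2^m))^2 = (2/e)/4^m.\<close>

lemma margin_Omega_binary:
  assumes n: "CARD('n::finite) = 2" and d: "CARD('d::finite) = 2 * m + e"
    and m: "m \<ge> 1" and e: "e \<ge> 1"
  shows "margin (Omega :: (real ^ 'n ^ 'd) set) \<le> sqrt (2 / e) / 2 ^ m"
proof -
  \<comment> \<open>\<open>D\<close> indexes both words and positions: a class of size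
    \<open>e\<close> at 0, then \<open>m\<close> pairs.\<close>
  define c where "c i = (if i = 0 then e else 2)" for i :: nat
  define D where "D = (SIGMA i:{..m}. {..<c i})"
  \<comment> \<open>Words \<open>(i, 0)\<close> and \<open>(i, 1)\<close> with \<open>i > 0\<close> differ only in the pairs \<open>k < i\<close>, where they
    are complementary, so that equal weights cancel there. Positions \<open>(0, a)\<close> detect \<open>P 0\<close>.\<close>
  define word :: "nat \<times> nat \<Rightarrow> nat \<times> nat \<Rightarrow> bool" where
    "word = (\<lambda>(i, b) (k, a).
      if k = 0 then i = m \<or> i = 0 \<and> b = a
      else if i < k then a = 0 else if i = k then a \<noteq> 0 else b = 0)"
  \<comment> \<open>The classes get masses 1, 1, 2, 4, ..., 2^(m-1) over 2^m, each the sum of the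
    earlier ones from class 1 on, split equally within a class.\<close>
  define w :: "nat \<times> nat \<Rightarrow> real" where
    "w = (\<lambda>(i, b). (if i = 0 then 1 / e else 2 ^ (i - 1) / 2) / 2 ^ m)"
  have sumD: "sum f D = (\<Sum>i\<le>m. \<Sum>b<c i. f (i, b))" for f :: "nat \<times> nat \<Rightarrow> real"
    by (simp add: D_def sum.Sigma)
  have split: "sum f {..m} = sum f {..<k} + f k + sum f {k<..m}"
    if "k \<le> m" for f :: "nat \<Rightarrow> real" and k
  proof -
    have "{..m} = insert k ({..<k} \<union> {k<..m})" using that by auto
    moreover have "sum f ({..<k} \<union> {k<..m}) = sum f {..<k} + sum f {k<..m}"
      by (rule sum.union_disjoint) auto
    ultimately show ?thesis by simp
  qed
  \<comment> \<open>The terms with i > k agree, so equal marginals at (k, 0) and (k, 1) say that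
    class k weighs as much as all earlier classes together.\<close>
  have marginals:
    "marginal D word u (k, 0) True
      = (\<Sum>i<k. \<Sum>b<c i. u (i, b)) + (\<Sum>i\<in>{k<..m}. u (i, 0))" (is ?lower)
    "marginal D word u (k, 1) True
      = (\<Sum>b<c k. u (k, b)) + (\<Sum>i\<in>{k<..m}. u (i, 0))" (is ?upper)
    if k: "1 \<le> k" "k \<le> m" for u k
  proof -
    have later: "(\<Sum>b<c i. if word (i, b) (k, a) then u (i, b) else 0) = u (i, 0)"
      if "i \<in> {k<..m}" for i a
      using k that by (auto simp: word_def c_def numeral_2_eq_2)
    show ?lower ?upper
      using k unfolding marginal_def sumD split[OF k(2)] eq_True
      by (auto simp: later cong: sum.cong) (auto simp: word_def c_def)
  qed
  have marginal_last: "marginal D word u (0, a) True = (\<Sum>b<c m. u (m, b)) + u (0, a)"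
    if a: "a < e" for u a
  proof -
    have zero: "(\<Sum>b<c 0. if word (0, b) (0, a) then u (0, b) else 0) = u (0, a)"
      using a m by (auto simp: word_def c_def sum.delta)
    have mid: "(\<Sum>b<c i. if word (i, b) (0, a) then u (i, b) else 0) = 0" if "i \<in> {0<..<m}" for i
      using that by (auto simp: word_def)
    have top: "(\<Sum>b<c m. if word (m, b) (0, a) then u (m, b) else 0) = (\<Sum>b<c m. u (m, b))"
      by (auto simp: word_def)
    have "{0<..m} = insert m {0<..<m}" using m by auto
    then show ?thesis
      unfolding marginal_def sumD split[OF le0] eq_True using zero mid top by simp
  qed
  have marginal_False: "marginal D word u j False = sum u D - marginal D word u j True" for u j
    unfolding marginal_def by (simp add: sum_subtractf[symmetric]) (rule sum.cong, auto)
  have P: "(\<Sum>b<c i. w (i, b)) = (if i = 0 then 1 else 2 ^ (i - 1)) / 2 ^ m" for i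
    using e by (simp add: w_def c_def)
  have sum_less: "(\<Sum>i<k. \<Sum>b<c i. w (i, b)) = 2 ^ (k - 1) / 2 ^ m" if "k \<ge> 1" for k
    using sum_doubling[OF that] by (simp add: P flip: sum_divide_distrib)
  have w1: "sum w D = 1"
    using sum_less[of "Suc m"] by (simp add: sumD lessThan_Suc_atMost)
  \<comment> \<open>Words (i, 0) carry half the mass of the later classes.\<close>
  have sum_greater: "(\<Sum>i\<in>{k<..m}. w (i, 0)) = 1 / 2 - 2 ^ (k - 1) / 2 ^ m"
    if "1 \<le> k" "k \<le> m" for k
  proof -
    have "(\<Sum>i\<in>{k<..m}. \<Sum>b<c i. w (i, b)) = (\<Sum>i\<in>{k<..m}. 2 * w (i, 0))"
      by (rule sum.cong) (auto simp: c_def w_def)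
    then have "2 * (\<Sum>i\<in>{k<..m}. w (i, 0)) = (\<Sum>i\<in>{k<..m}. \<Sum>b<c i. w (i, b))"
      by (simp add: sum_distrib_left)
    also have "\<dots> = 1 - (\<Sum>i<k. \<Sum>b<c i. w (i, b)) - (\<Sum>b<c k. w (k, b))"
      using w1 split[OF that(2), of "\<lambda>i. \<Sum>b<c i. w (i, b)"] by (simp add: sumD)
    finally show ?thesis using that sum_less[OF that(1)] P[of k] by simp
  qed
  have dev: "(\<Sum>i\<in>UNIV. (marginal D word w j i - 1 / 2)\<^sup>2)
      = (if fst j = 0 then 2 * (1 / e / 2 ^ m)\<^sup>2 else 0)" if "j \<in> D" for j
  proof -
    obtain k a where j: "j = (k, a)" by force
    with that have k: "k \<le> m" and a: "a < c k" by (auto simp: D_def)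
    have "marginal D word w j True = (if k = 0 then 1 / 2 + 1 / e / 2 ^ m else 1 / 2)"
    proof (cases "k = 0")
      case True
      have "(2::real) ^ (m - 1) / 2 ^ m = 1 / 2"
        using m by (simp add: power_diff)
      with True show ?thesis using a marginal_last[of a w] P[of m] m
        by (simp add: j c_def) (simp add: w_def)
    next
      case False
      then have "1 \<le> k" "a = 0 \<or> a = 1" using a by (auto simp: c_def)
      then show ?thesis
        using False k marginals[of k w] sum_less[of k] sum_greater[of k] P[of k] by (auto simp: j)
    qed
    then show ?thesis
      using marginal_False[of w j] w1 by (simp add: UNIV_bool j power2_eq_square)
  qed
  show ?thesis
  proof (rule margin_Omega_le[where T = D and D = D and L = "UNIV :: bool set" and word = word and w = w])
    show "finite D" by (simp add: D_def)
    have "card D = (\<Sum>i\<le>m. c i)" by (simp add: D_def)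
    also have "\<dots> = 2 * m + e"
      by (induction m) (auto simp: c_def)
    finally show "card D = CARD('d)" using d by simp
    show "card (UNIV :: bool set) = CARD('n)" using n by simp
    show "word t j \<in> UNIV" for t j by simp
    show "0 \<le> w t" for t by (simp add: w_def split: prod.split)
    show "sum w D = 1" by (fact w1)
    show "0 \<le> sqrt (2 / e) / 2 ^ m" by simp
    have "(\<Sum>j\<in>D. \<Sum>i\<in>UNIV. (marginal D word w j i - 1 / real CARD('n))\<^sup>2)
        = (\<Sum>j\<in>D. if fst j = 0 then 2 * (1 / e / 2 ^ m)\<^sup>2 else 0)"
      using dev by (simp add: n)
    also have "\<dots> = e * (2 * (1 / e / 2 ^ m)\<^sup>2)"
      unfolding sumD split[OF le0] by (simp add: c_def)
    also have "\<dots> = (sqrt (2 / e) / 2 ^ m)\<^sup>2"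
      using e by (simp add: power_divide power2_eq_square real_sqrt_mult[symmetric])
    finally show "(\<Sum>j\<in>D. \<Sum>i\<in>UNIV. (marginal D word w j i - 1 / real CARD('n))\<^sup>2)
        \<le> (sqrt (2 / e) / 2 ^ m)\<^sup>2" by simp
  next
    fix u :: "nat \<times> nat \<Rightarrow> real"
    assume u0: "\<And>t. t \<in> D \<Longrightarrow> 0 \<le> u t" and u1: "sum u D = 1"
      and uniform: "\<And>j i. j \<in> D \<Longrightarrow> i \<in> UNIV \<Longrightarrow> marginal D word u j i = 1 / real CARD('n)"
    define Q where "Q i = (\<Sum>b<c i. u (i, b))" for i
    have half: "marginal D word u (k, a) True = 1 / 2" if "k \<le> m" "a < c k" for k a
      using uniform[of "(k, a)" True] that n by (simp add: D_def)
    have Q: "Q k = (\<Sum>i<k. Q i)" if "1 \<le> k" "k \<le> m" for k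
      using marginals[OF that, of u] half[of k 0] half[of k 1] that by (simp add: Q_def c_def)
    have "(\<Sum>i<m. Q i) + Q m = 1"
      using u1 by (simp add: sumD Q_def lessThan_Suc_atMost[symmetric])
    then have Qm: "Q m = 1 / 2" using Q[of m] m by simp
    \<comment> \<open>Class m already has mass 1/2, which leaves nothing for class 0; the recursion
      then makes every class vanish, including class m.\<close>
    have "u (0, a) = 0" if "a < e" for a
      using marginal_last[OF that, of u] half[of 0 a] that Qm by (simp add: Q_def c_def)
    then have "Q 0 = 0" by (simp add: Q_def c_def)
    have "Q k = 0" if "k \<le> m" for k
      using that
    proof (induction k rule: less_induct)
      case (less k)
      then show ?case using Q[of k] \<open>Q 0 = 0\<close> by (cases "k = 0") auto
    qed
    with Qm show False by simp
  qed
qed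

section \<open>Maps from rn letters onto n letters that detect the uniform distribution\<close>

text \<open>
  Writing s = y + n c with y < n, the maps for k < r shift y cyclically in the layers c < k, so that
  consecutive ones compare neighbouring values within layer k; each of the remaining r - 1 maps
  swaps one element of another layer with 0, which compares two layers.
\<close>

definition split_digit :: "nat \<Rightarrow> nat \<Rightarrow> nat \<Rightarrow> nat \<Rightarrow> nat" where
  "split_digit n r k s =
    (if k < r then (s mod n + of_bool (s div n < k)) mod n
     else Transposition.transpose 0 (1 + n * (k - r + 1)) s mod n)"

lemma sum_lessThan_mult:
  "(\<Sum>s<r * n. f s) = (\<Sum>c<r. \<Sum>y<n. f (y + n * c))" for f :: "nat \<Rightarrow> real"
proof -
  have "(\<Sum>s<r * n. f s) = (\<Sum>c<r. \<Sum>s\<in>{c * n..<c * n + n}. f s)"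
    by (rule sum.nat_group[symmetric])
  also have "\<dots> = (\<Sum>c<r. \<Sum>y<n. f (y + n * c))"
  proof (rule sum.cong[OF refl])
    show "(\<Sum>s\<in>{c * n..<c * n + n}. f s) = (\<Sum>y<n. f (y + n * c))" for c
      using sum.shift_bounds_nat_ivl[of f 0 "c * n" n]
      by (simp add: lessThan_atLeast0 ac_simps)
  qed
  finally show ?thesis .
qed

lemma sum_shift_mod:
  fixes f :: "nat \<Rightarrow> real"
  assumes "x < n"
  shows "(\<Sum>y<n. if (y + of_bool b) mod n = x then f y else 0)
    = f (if b then (if x = 0 then n - 1 else x - 1) else x)"
proof -
  have "(y + of_bool b) mod n = x \<longleftrightarrow> y = (if b then (if x = 0 then n - 1 else x - 1) else x)"
    if "y < n" for y
    using that assms by (cases "Suc y = n") auto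
  then have "(\<Sum>y<n. if (y + of_bool b) mod n = x then f y else 0)
      = (\<Sum>y<n. if y = (if b then (if x = 0 then n - 1 else x - 1) else x) then f y else 0)"
    by (intro sum.cong) auto
  also have "\<dots> = f (if b then (if x = 0 then n - 1 else x - 1) else x)"
    using assms by (subst sum.delta) auto
  finally show ?thesis .
qed

text \<open>The fibre over \<open>x\<close> meets each layer once: in the cyclic predecessor of
  \<open>x\<close> in the shifted layers, in \<open>x\<close> itself in the others.\<close>

lemma sum_split_digit_shift:
  fixes f :: "nat \<Rightarrow> real"
  assumes "x < n" and "k < r"
  shows "(\<Sum>s<r * n. if split_digit n r k s = x then f s else 0)
    = (\<Sum>c<r. f ((if c < k then (if x = 0 then n - 1 else x - 1) else x) + n * c))"
  unfolding sum_lessThan_mult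
proof (rule sum.cong[OF refl])
  fix c assume "c \<in> {..<r}"
  have "(\<Sum>y<n. if split_digit n r k (y + n * c) = x then f (y + n * c) else 0)
      = (\<Sum>y<n. if (y + of_bool (c < k)) mod n = x then f (y + n * c) else 0)"
    using assms by (intro sum.cong) (auto simp: split_digit_def)
  then show "(\<Sum>y<n. if split_digit n r k (y + n * c) = x then f (y + n * c) else 0)
      = f ((if c < k then (if x = 0 then n - 1 else x - 1) else x) + n * c)"
    using sum_shift_mod[OF assms(1), of "c < k" "\<lambda>y. f (y + n * c)"] by simp
qed

text \<open>Index \<open>r + c - 1\<close> selects the swap of 0 with the element y = 1 of layer
  \<open>c\<close>; reindexing by this involution turns the fibre into a residue class.\<close>

lemma sum_split_digit_transpose:
  fixes f :: "nat \<Rightarrow> real"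
  assumes "x < n" and "1 \<le> c" and "c < r" and "n \<ge> 2"
  shows "(\<Sum>s<r * n. if split_digit n r (r + c - 1) s = x then f s else 0)
    = (\<Sum>a<r. f (Transposition.transpose 0 (1 + n * c) (x + n * a)))"
proof -
  have "1 + n * c < n * (c + 1)" using assms by simp
  also have "\<dots> \<le> n * r" using assms by (intro mult_le_mono2) simp
  also have "\<dots> = r * n" by simp
  finally have perm: "Transposition.transpose 0 (1 + n * c) permutes {..<r * n}"
    using assms by (intro permutes_swap_id) auto
  have "(\<Sum>s<r * n. if split_digit n r (r + c - 1) s = x then f s else 0)
      = (\<Sum>s<r * n. if Transposition.transpose 0 (1 + n * c) s mod n = x then f s else 0)"
  proof -
    have "\<not> r + c - 1 < r" "r + c - 1 - r + 1 = c" using assms by auto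
    then show ?thesis by (simp only: split_digit_def if_False)
  qed
  also have "\<dots> = (\<Sum>s<r * n. if s mod n = x then f (Transposition.transpose 0 (1 + n * c) s) else 0)"
    by (subst sum.permute[OF perm]) (simp only: o_def transpose_involutory)
  also have "\<dots> = (\<Sum>a<r. f (Transposition.transpose 0 (1 + n * c) (x + n * a)))"
    unfolding sum_lessThan_mult using assms(1)
    by (intro sum.cong refl) (simp add: sum.delta)
  finally show ?thesis .
qed

lemma card_split_digit:
  assumes "x < n" and "n \<ge> 2" and "k < 2 * r - 1"
  shows "(\<Sum>s<r * n. if split_digit n r k s = x then 1 else 0) = real r"
proof (cases "k < r")
  case True
  then show ?thesis using sum_split_digit_shift[OF assms(1), of k r "\<lambda>_. 1"] by simp
next
  case False
  then show ?thesis
    using sum_split_digit_transpose[of x n "k - r + 1" r "\<lambda>_. 1"] assms by simp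
qed

text \<open>Shifts \<open>k\<close> and \<open>k + 1\<close> differ only in layer \<open>k\<close>,
  which makes \<open>f\<close> constant on all layers but the last; equal residue class sums settle
  the last one. The swaps then equate each layer with layer 0, and the total fixes the common
  value.\<close>

lemma uniform_if_split_digits_uniform:
  fixes f :: "nat \<Rightarrow> real"
  assumes n: "n \<ge> 2" and s: "s < r * n"
    and uniform: "\<And>k x. k < 2 * r - 1 \<Longrightarrow> x < n \<Longrightarrow>
      (\<Sum>s<r * n. if split_digit n r k s = x then f s else 0) = 1 / n"
  shows "f s = 1 / (real r * real n)"
proof -
  have r: "r \<ge> 1" using s by (cases r) auto
  define F where "F y c = f (y + n * c)" for y c
  define prev where "prev x = (if x = 0 then n - 1 else x - 1)" for x
  have shift: "(\<Sum>c<r. F (if c < k then prev x else x) c) = 1 / n" if "k < r" "x < n" for k x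
    using uniform[of k x] sum_split_digit_shift[of x n k r f] that r
    unfolding F_def prev_def by simp
  have layer: "(\<Sum>c<r. F x c) = 1 / n" if "x < n" for x
    using shift[of 0 x] r that by simp
  have step: "F (Suc x) k = F x k" if k: "Suc k < r" and x: "Suc x < n" for k x
  proof -
    have "(\<Sum>c<r. F (if c < Suc k then x else Suc x) c) - (\<Sum>c<r. F (if c < k then x else Suc x) c)
        = (\<Sum>c<r. if c = k then F x k - F (Suc x) k else 0)"
      unfolding sum_subtractf[symmetric] by (intro sum.cong) auto
    also have "\<dots> = F x k - F (Suc x) k" using k by simp
    finally have "(\<Sum>c<r. F (if c < Suc k then x else Suc x) c)
        - (\<Sum>c<r. F (if c < k then x else Suc x) c) = F x k - F (Suc x) k" .
    moreover have prev: "prev (Suc x) = x" by (simp add: prev_def)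
    ultimately show ?thesis
      using shift[of "Suc k" "Suc x", unfolded prev] shift[of k "Suc x", unfolded prev] k x by simp
  qed
  have const: "F x c = F 0 c" if "c < r" "x < n" for x c
  proof (cases "Suc c < r")
    case True
    show ?thesis using that(2) by (induction x) (auto simp: step[OF True])
  next
    \<comment> \<open>Shift \<open>r\<close> is not among the maps, so the last layer is recovered
      by subtracting the other layers from the residue class sum.\<close>
    case False
    then have rc: "r = Suc c" using that by simp
    have "F y a = F 0 a" if "a < c" "y < n" for y a
      using that(2) by (induction y) (use that(1) rc step in auto)
    then have sums: "(\<Sum>a<c. F x a) = (\<Sum>a<c. F 0 a)" using that by (intro sum.cong refl) blast
    have last: "(\<Sum>a<c. F y a) + F y c = 1 / n" if "y < n" for y
      using layer[OF that] unfolding rc lessThan_Suc by simp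
    show ?thesis using sums last[of x] last[of 0] that(2) by linarith
  qed
  have link: "F 1 c = F 0 0" if c: "1 \<le> c" "c < r" for c
  proof -
    have "(\<Sum>a<r. f (Transposition.transpose 0 (1 + n * c) (0 + n * a))) = 1 / n"
      using sum_split_digit_transpose[of 0 n c r f] uniform[of "r + c - 1" 0] c n by simp
    moreover have "f (Transposition.transpose 0 (1 + n * c) (0 + n * a)) = (if a = 0 then F 1 c else F 0 a)" for a
    proof -
      \<comment> \<open>The swap moves only one multiple of n, namely 0, since 1 + n c is not
        divisible by n.\<close>
      have "n * a \<noteq> 1 + n * c"
      proof
        assume "n * a = 1 + n * c"
        then have "n dvd 1 + n * c" by (metis dvd_triv_left)
        then have "n dvd 1" by (metis dvd_add_left_iff dvd_triv_left)
        then show False using n by simp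
      qed
      then show ?thesis using n by (auto simp: F_def Transposition.transpose_def)
    qed
    ultimately have "(\<Sum>a<r. if a = 0 then F 1 c else F 0 a) = (\<Sum>a<r. F 0 a)"
      using layer[of 0] n by simp
    moreover have "(\<Sum>a<r. if a = 0 then F 1 c else F 0 a) - (\<Sum>a<r. F 0 a)
        = (\<Sum>a<r. if a = 0 then F 1 c - F 0 0 else 0)"
      unfolding sum_subtractf[symmetric] by (intro sum.cong) auto
    ultimately show ?thesis using r by simp
  qed
  have all: "F x c = F 0 0" if "c < r" "x < n" for x c
    using const[OF that] const[of c 1] link[of c] that n by (cases "c = 0") auto
  have "(\<Sum>c<r. F 0 c) = (\<Sum>c<r. F 0 0)" using n by (intro sum.cong refl all) auto
  then have "(\<Sum>c<r. F 0 c) = r * F 0 0" by simp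
  then have "F 0 0 = 1 / (real r * real n)" using layer[of 0] n r by (simp add: field_simps)
  moreover have "s div n < r" using s by (simp add: less_mult_imp_div_less)
  moreover have "f s = F (s mod n) (s div n)" by (simp add: F_def)
  ultimately show ?thesis using all[of "s div n" "s mod n"] n by simp
qed

section \<open>The chain of triples and its almost uniform weights\<close>

text \<open>
  The letter at position l of the triples (s,0,s), (s,s,0), (s-1,s,s), selected by \<open>\<kappa> = 0, 1, 2\<close>.
\<close>

definition chain_index :: "nat \<times> nat \<Rightarrow> nat \<Rightarrow> nat" where
  "chain_index = (\<lambda>(\<kappa>, s) l.
    if \<kappa> = 2 \<and> l = 0 then s - 1 else if \<kappa> = 0 \<and> l = 1 \<or> \<kappa> = 1 \<and> l = 2 then 0 else s)"

lemma sum_chain: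
  "(\<Sum>t\<in>{..<3} \<times> {1..<N}. f t)
    = (\<Sum>s\<in>{1..<N}. f (0, s)) + (\<Sum>s\<in>{1..<N}. f (1, s)) + (\<Sum>s\<in>{1..<N}. f (2, s))"
  for f :: "nat \<times> nat \<Rightarrow> real"
  by (simp add: sum.cartesian_product' numeral_3_eq_3 numeral_2_eq_2)

text \<open>The only coupling between different \<open>s > 0\<close> is at position 0, where letter
  \<open>s\<close> also occurs in the triple of kind 2 with index \<open>s + 1\<close>. That triple
  is missing for s = N - 1, and letter 0 there occurs only in (0,1,1).\<close>

lemma chain_marginals:
  fixes u :: "nat \<times> nat \<Rightarrow> real" and N :: nat
  defines "M \<equiv> marginal ({..<3} \<times> {1..<N}) chain_index u"
  assumes N: "N \<ge> 2"
  shows "M 0 0 = u (2, 1)"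
    and "\<lbrakk>1 \<le> s; s < N - 1\<rbrakk> \<Longrightarrow> M 0 s = u (0, s) + u (1, s) + u (2, s + 1)"
    and "M 0 (N - 1) = u (0, N - 1) + u (1, N - 1)"
    and "M 1 0 = (\<Sum>s\<in>{1..<N}. u (0, s))"
    and "\<lbrakk>1 \<le> s; s < N\<rbrakk> \<Longrightarrow> M 1 s = u (1, s) + u (2, s)"
    and "M 2 0 = (\<Sum>s\<in>{1..<N}. u (1, s))"
    and "\<lbrakk>1 \<le> s; s < N\<rbrakk> \<Longrightarrow> M 2 s = u (0, s) + u (2, s)"
proof -
  have pred: "(\<Sum>i\<in>{1..<N}. if i - 1 = s then u (2, i) else 0)
      = (if s + 1 < N then u (2, s + 1) else 0)" for s
  proof -
    have "(\<Sum>i\<in>{1..<N}. if i - 1 = s then u (2, i) else 0)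
        = (\<Sum>i\<in>{1..<N}. if i = s + 1 then u (2, i) else 0)"
      by (rule sum.cong) auto
    then show ?thesis by simp
  qed
  have zero: "(\<Sum>i\<in>{1..<N}. if i = 0 then g i else 0) = 0" for g :: "nat \<Rightarrow> real"
    by (rule sum.neutral) auto
  show "M 0 0 = u (2, 1)"
    using N pred[of 0] zero unfolding M_def marginal_def sum_chain chain_index_def
    by (simp del: diff_is_0_eq)
  show "M 0 s = u (0, s) + u (1, s) + u (2, s + 1)" if "1 \<le> s" "s < N - 1"
  proof -
    have "s + 1 < N" using that by simp
    then show ?thesis
      using that pred[of s] unfolding M_def marginal_def sum_chain chain_index_def by simp
  qed
  show "M 0 (N - 1) = u (0, N - 1) + u (1, N - 1)"
    and "M 1 0 = (\<Sum>s\<in>{1..<N}. u (0, s))"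
    and "\<lbrakk>1 \<le> s; s < N\<rbrakk> \<Longrightarrow> M 1 s = u (1, s) + u (2, s)"
    and "M 2 0 = (\<Sum>s\<in>{1..<N}. u (1, s))"
    and "\<lbrakk>1 \<le> s; s < N\<rbrakk> \<Longrightarrow> M 2 s = u (0, s) + u (2, s)"
    using N pred zero unfolding M_def marginal_def sum_chain chain_index_def by simp_all
qed

text \<open>Letter 0 at position 0 forces \<open>u (2, 1) = q\<close>. Then the weights of kinds 0
  and 1 at 1 vanish, which forces \<open>u (2, 2) = q\<close>, and so on; letter
  \<open>N - 1\<close> is left with marginal 0.\<close>

lemma chain_not_uniform:
  fixes u :: "nat \<times> nat \<Rightarrow> real"
  assumes N: "N \<ge> 2" and "q \<noteq> 0"
  shows "\<exists>l<3. \<exists>s<N. marginal ({..<3} \<times> {1..<N}) chain_index u l s \<noteq> q"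
proof (rule ccontr)
  assume "\<not> ?thesis"
  then have *: "marginal ({..<3} \<times> {1..<N}) chain_index u l s = q" if "l < 3" "s < N" for l s
    using that by blast
  note M = chain_marginals[OF N, where u = u]
  have legs: "u (1, s) = q - u (2, s)" "u (0, s) = q - u (2, s)" if "1 \<le> s" "s < N" for s
    using M(5,7)[OF that] *[of 1 s] *[of 2 s] that by simp_all
  have "u (2, s) = q" if "1 \<le> s" "s < N" for s
    using that
  proof (induction s rule: dec_induct)
    case base
    then show ?case using M(1) *[of 0 0] N by simp
  next
    case (step s)
    then show ?case using M(2)[of s] *[of 0 s] legs[of s] by simp
  qed
  then show False using M(3) *[of 0 "N - 1"] legs[of "N - 1"] N \<open>q \<noteq> 0\<close> by simp
qed

text \<open>Before normalisation, kinds 0 and 1 double with \<open>s\<close> and reach 1/2 at s = N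
  - 1, so that together they give the last letter marginal 1; kind 2 is the complement to 1. The
  only defect is 2^-(N-1) at letter 0 in each position, and the denominator is the total
  weight.\<close>

definition chain_weight :: "nat \<Rightarrow> nat \<times> nat \<Rightarrow> real" where
  "chain_weight N = (\<lambda>(\<kappa>, s).
    (if \<kappa> = 2 then 1 - 2 ^ (s - 1) / 2 ^ (N - 1) else 2 ^ (s - 1) / 2 ^ (N - 1))
      / (N - 1 / 2 ^ (N - 1)))"

lemma sum_powers_of_2:
  "N \<ge> 1 \<Longrightarrow> (\<Sum>s\<in>{1..<N}. 2 ^ (s - 1)) = (2 ^ (N - 1) - 1 :: real)"
proof (induction N rule: dec_induct)
  case base
  then show ?case by simp
next
  case (step N)
  then show ?case by (cases N) auto
qed

lemma chain_weight_denom_pos: "N \<ge> 2 \<Longrightarrow> real N - 1 / 2 ^ (N - 1) > 0"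
proof -
  assume "N \<ge> 2"
  moreover have "1 / 2 ^ (N - 1) \<le> (1::real)" by simp
  ultimately show ?thesis by linarith
qed

lemma chain_weight_nonneg:
  assumes "N \<ge> 2" and "t \<in> {..<3} \<times> {1..<N}"
  shows "0 \<le> chain_weight N t"
proof -
  obtain \<kappa> s where t: "t = (\<kappa>, s)" "s < N" using assms(2) by auto
  then have "(2::real) ^ (s - 1) \<le> 2 ^ (N - 1)" by (intro power_increasing) auto
  then show ?thesis using chain_weight_denom_pos[OF assms(1)]
    by (simp add: chain_weight_def t)
qed

lemma sum_chain_weight:
  assumes N: "N \<ge> 2"
  shows "sum (chain_weight N) ({..<3} \<times> {1..<N}) = 1"
proof -
  let ?d = "real N - 1 / 2 ^ (N - 1)"
  have "sum (chain_weight N) ({..<3} \<times> {1..<N})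
      = (\<Sum>s\<in>{1..<N}. (1 + 2 ^ (s - 1) / 2 ^ (N - 1)) / ?d)"
    unfolding sum_chain sum.distrib[symmetric]
    by (intro sum.cong) (auto simp: chain_weight_def add_divide_distrib diff_divide_distrib)
  also have "\<dots> = (real (N - 1) + (2 ^ (N - 1) - 1) / 2 ^ (N - 1)) / ?d"
    using N sum_powers_of_2[of N] by (simp add: sum.distrib flip: sum_divide_distrib)
  also have "real (N - 1) + (2 ^ (N - 1) - 1) / 2 ^ (N - 1) = ?d"
    using N by (simp add: diff_divide_distrib of_nat_diff)
  finally show ?thesis using chain_weight_denom_pos[OF N] by simp
qed

lemma marginal_chain_weight:
  assumes N: "N \<ge> 2" and l: "l < 3" and s: "s < N"
  shows "marginal ({..<3} \<times> {1..<N}) chain_index (chain_weight N) l s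
    = (1 - (if s = 0 then 1 / 2 ^ (N - 1) else 0)) / (N - 1 / 2 ^ (N - 1))"
proof -
  let ?d = "real N - 1 / 2 ^ (N - 1)"
  have W: "chain_weight N (0, s) = 2 ^ (s - 1) / 2 ^ (N - 1) / ?d"
     "chain_weight N (1, s) = 2 ^ (s - 1) / 2 ^ (N - 1) / ?d"
     "chain_weight N (2, s) = (1 - 2 ^ (s - 1) / 2 ^ (N - 1)) / ?d" for s
    by (simp_all add: chain_weight_def)
  note M = chain_marginals[OF N, where u = "chain_weight N", unfolded W]
  have sums: "(\<Sum>s\<in>{1..<N}. 2 ^ (s - 1) / 2 ^ (N - 1) / ?d) = (1 - 1 / 2 ^ (N - 1)) / ?d"
    using sum_powers_of_2[of N] N by (simp add: diff_divide_distrib flip: sum_divide_distrib)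
  have double: "2 ^ (s - 1) + 2 ^ (s - 1) = (2 ^ s :: real)" if "1 \<le> s" for s
    using that by (cases s) auto
  consider "l = 0" "s = 0" | "l = 0" "1 \<le> s" "s < N - 1" | "l = 0" "s = N - 1" "1 \<le> s"
    | "l = 1" "s = 0" | "l = 1" "1 \<le> s" | "l = 2" "s = 0" | "l = 2" "1 \<le> s"
    using l s by linarith
  then show ?thesis
  proof cases
    case 1
    then show ?thesis using M(1) by simp
  next
    case 2
    \<comment> \<open>The two legs at \<open>s\<close> add up to exactly what kind 2 lacks at
      \<open>s + 1\<close>.\<close>
    have "2 ^ (s - 1) / 2 ^ (N - 1) / ?d + 2 ^ (s - 1) / 2 ^ (N - 1) / ?d + (1 - 2 ^ s / 2 ^ (N - 1)) / ?d
        = 1 / ?d"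
      unfolding double[OF 2(2), symmetric] by (simp add: add_divide_distrib diff_divide_distrib)
    with 2 show ?thesis using M(2)[of s] by simp
  next
    case 3
    have "2 ^ (s - 1) / 2 ^ s / ?d + 2 ^ (s - 1) / 2 ^ s / ?d = 1 / ?d"
      unfolding add_divide_distrib[symmetric] double[OF 3(3)] by simp
    with 3 show ?thesis using M(3) N by simp
  next
    case 4
    then show ?thesis using M(4) sums by simp
  next
    case 5
    then show ?thesis using M(5)[of s] s by (simp add: diff_divide_distrib)
  next
    case 6
    then show ?thesis using M(6) sums by simp
  next
    case 7
    then show ?thesis using M(7)[of s] s by (simp add: diff_divide_distrib)
  qed
qed

section \<open>Splitting each letter of the chain into 2r-1 digits\<close>

text \<open>The marginal at (l, k) is the pushforward of the marginal at \<open>l\<close> under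
  \<open>dig k\<close>.\<close>

lemma marginal_split:
  fixes N :: nat
  assumes "\<And>t. t \<in> T \<Longrightarrow> idx t l < N"
  shows "marginal T (\<lambda>t (l, k). dig k (idx t l)) u (l, k) x
    = (\<Sum>s<N. if dig k s = x then marginal T idx u l s else 0)"
proof -
  have "marginal T (\<lambda>t (l, k). dig k (idx t l)) u (l, k) x
      = (\<Sum>t\<in>T. \<Sum>s<N. if s = idx t l then if dig k s = x then u t else 0 else 0)"
    unfolding marginal_def using assms by (intro sum.cong) auto
  also have "\<dots> = (\<Sum>s<N. \<Sum>t\<in>T. if s = idx t l then if dig k s = x then u t else 0 else 0)"
    by (rule sum.swap)
  also have "\<dots> = (\<Sum>s<N. if dig k s = x then marginal T idx u l s else 0)"
    unfolding marginal_def by (intro sum.cong) (auto intro!: sum.cong sum.neutral)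
  finally show ?thesis .
qed

text \<open>Uniform digit marginals lift to uniform chain marginals, which are impossible. For
  \<open>chain_weight\<close>, each of the 3(2r-1) positions contributes at most
  (\<delta>/(N-\<delta>))^2 to the squared norm.\<close>

lemma margin_Omega_chain:
  assumes n: "CARD('n::finite) \<ge> 2" and r: "r \<ge> 1" and d: "CARD('d::finite) = 3 * (2 * r - 1)"
  shows "margin (Omega :: (real ^ 'n ^ 'd) set)
    \<le> sqrt (3 * (2 * real r - 1)) / (r * (real CARD('n) - 1)) / 2 ^ (r * CARD('n) - 1)"
proof -
  let ?n = "CARD('n)"
  define N where "N = r * ?n"
  define \<delta> where "\<delta> = 1 / (2::real) ^ (N - 1)"
  define T :: "(nat \<times> nat) set" where "T = {..<3} \<times> {1..<N}"
  define D :: "(nat \<times> nat) set" where "D = {..<3} \<times> {..<2 * r - 1}"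
  define word where "word = (\<lambda>t (l, k). split_digit ?n r k (chain_index t l))"
  have "1 * 2 \<le> r * ?n" using n r by (rule mult_le_mono[rotated])
  then have N: "N \<ge> 2" by (simp add: N_def)
  have idx: "chain_index t l < N" if "t \<in> T" for t l
    using that by (auto simp: T_def chain_index_def split: prod.split)
  have marg: "marginal T word u (l, k) x
      = (\<Sum>s<N. if split_digit ?n r k s = x then marginal T chain_index u l s else 0)" for u l k x
    unfolding word_def by (rule marginal_split) (rule idx)
  have d0: "real N - \<delta> > 0" using chain_weight_denom_pos[OF N] by (simp add: \<delta>_def)
  \<comment> \<open>All fibres have size \<open>r\<close>, so the defect at letter 0 becomes a
    multiple of the uniform distribution minus the point mass at the digit of 0.\<close>
  have dev: "marginal T word (chain_weight N) (l, k) x - 1 / ?n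
      = \<delta> / (N - \<delta>) * (1 / ?n - (if x = split_digit ?n r k 0 then 1 else 0))"
    if "l < 3" "k < 2 * r - 1" "x < ?n" for l k x
  proof -
    have base: "marginal T chain_index (chain_weight N) l s
        = (1 - (if s = 0 then \<delta> else 0)) / (N - \<delta>)" if "s < N" for s
      using marginal_chain_weight[OF N \<open>l < 3\<close> that] by (simp only: T_def \<delta>_def)
    have "marginal T word (chain_weight N) (l, k) x
      = (\<Sum>s<N. (if split_digit ?n r k s = x then 1 else 0) * (1 / (N - \<delta>))
            - (if s = 0 then if split_digit ?n r k 0 = x then \<delta> / (N - \<delta>) else 0 else 0))"
      unfolding marg
      by (intro sum.cong refl) (simp add: base diff_divide_distrib)
    also have "\<dots> = r / (N - \<delta>) - (if split_digit ?n r k 0 = x then \<delta> / (N - \<delta>) else 0)"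
      using card_split_digit[OF \<open>x < ?n\<close> n \<open>k < 2 * r - 1\<close>] N r
      by (simp add: sum_subtractf N_def flip: sum_distrib_right sum_divide_distrib)
    also have "r / (N - \<delta>) = 1 / ?n + \<delta> / (N - \<delta>) * (1 / ?n)"
      using d0 n by (simp add: N_def field_simps)
    finally show ?thesis by (auto simp: algebra_simps)
  qed
  have digit: "split_digit ?n r k s < ?n" for k s using n by (simp add: split_digit_def)
  have spike: "(\<Sum>x<m. (1 / m - (if x = z then 1 else 0))\<^sup>2) = 1 - 1 / m" if "z < m" for z m :: nat
  proof -
    have "(\<Sum>x<m. (1 / m - (if x = z then 1 else 0))\<^sup>2)
        = (\<Sum>x<m. (1 / m)\<^sup>2 + (if x = z then 1 - 2 / m else 0))"
      by (intro sum.cong) (auto simp: power2_eq_square algebra_simps)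
    also have "\<dots> = 1 - 1 / m"
      unfolding sum.distrib using that by (simp add: power2_eq_square field_simps)
    finally show ?thesis .
  qed
  have sq: "(\<Sum>x<?n. (marginal T word (chain_weight N) (l, k) x - 1 / ?n)\<^sup>2) \<le> (\<delta> / (N - \<delta>))\<^sup>2"
    if "l < 3" "k < 2 * r - 1" for l k
  proof -
    have "(\<Sum>x<?n. (marginal T word (chain_weight N) (l, k) x - 1 / ?n)\<^sup>2)
        = (\<Sum>x<?n. (\<delta> / (N - \<delta>))\<^sup>2 * (1 / ?n - (if x = split_digit ?n r k 0 then 1 else 0))\<^sup>2)"
      by (intro sum.cong refl) (simp only: dev[OF that] lessThan_iff power_mult_distrib)
    also have "\<dots> = (\<delta> / (N - \<delta>))\<^sup>2 * (1 - 1 / ?n)"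
      unfolding sum_distrib_left[symmetric] spike[OF digit] ..
    also have "\<dots> \<le> (\<delta> / (N - \<delta>))\<^sup>2 * 1" by (intro mult_left_mono) auto
    finally show ?thesis by simp
  qed
  define B where "B = sqrt (3 * (2 * real r - 1)) * (\<delta> / (N - \<delta>))"
  have "margin (Omega :: (real ^ 'n ^ 'd) set) \<le> B"
  proof (rule margin_Omega_le[where T = T and D = D and L = "{..<?n}" and word = word and w = "chain_weight N"])
    show "finite T" by (simp add: T_def)
    show "card D = CARD('d)" by (simp add: D_def d)
    show "card {..<?n} = ?n" by simp
    show "word t j \<in> {..<?n}" for t j by (simp add: word_def digit split: prod.split)
    show "0 \<le> chain_weight N t" if "t \<in> T" for t
      using chain_weight_nonneg[OF N] that by (simp add: T_def)
    show "sum (chain_weight N) T = 1" using sum_chain_weight[OF N] by (simp add: T_def)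
    show "0 \<le> B"
      unfolding B_def using d0 r by (intro mult_nonneg_nonneg divide_nonneg_nonneg) (auto simp: \<delta>_def)
    have "(\<Sum>j\<in>D. \<Sum>x<?n. (marginal T word (chain_weight N) j x - 1 / ?n)\<^sup>2)
        \<le> (\<Sum>j\<in>D. (\<delta> / (N - \<delta>))\<^sup>2)"
      by (rule sum_mono) (use sq in \<open>auto simp: D_def\<close>)
    also have "\<dots> = 3 * (2 * real r - 1) * (\<delta> / (N - \<delta>))\<^sup>2"
      using r by (simp add: D_def of_nat_diff)
    also have "\<dots> = B\<^sup>2"
      unfolding B_def power_mult_distrib using r by (subst real_sqrt_pow2) auto
    finally show "(\<Sum>j\<in>D. \<Sum>x<?n. (marginal T word (chain_weight N) j x - 1 / ?n)\<^sup>2) \<le> B\<^sup>2" .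
  next
    fix u :: "nat \<times> nat \<Rightarrow> real"
    assume uniform: "\<And>j x. j \<in> D \<Longrightarrow> x \<in> {..<?n} \<Longrightarrow> marginal T word u j x = 1 / ?n"
    have "marginal T chain_index u l s = 1 / (real r * real ?n)" if "l < 3" "s < N" for l s
    proof (rule uniform_if_split_digits_uniform[OF n, where f = "marginal T chain_index u l"])
      show "s < r * ?n" using that by (simp add: N_def)
      show "(\<Sum>s<r * ?n. if split_digit ?n r k s = x then marginal T chain_index u l s else 0) = 1 / ?n"
        if "k < 2 * r - 1" "x < ?n" for k x
        using uniform[of "(l, k)" x] that \<open>l < 3\<close> marg[of u l k x] by (simp add: D_def N_def)
    qed
    then show False
      using chain_not_uniform[OF N, of "1 / (real r * real ?n)" u] n r by (auto simp: T_def)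
  qed
  also have "\<dots> \<le> sqrt (3 * (2 * real r - 1)) / (r * (real ?n - 1)) / 2 ^ (N - 1)"
  proof -
    have "\<delta> \<le> 1" by (simp add: \<delta>_def)
    \<comment> \<open>This uses \<delta> \<le> 1 \<le> r and N = rn.\<close>
    then have "r * (real ?n - 1) \<le> N - \<delta>" using r by (simp add: N_def algebra_simps)
    moreover have "0 < r * (real ?n - 1)" using n r by simp
    ultimately have "\<delta> / (N - \<delta>) \<le> \<delta> / (r * (real ?n - 1))"
      by (intro divide_left_mono) (use d0 in \<open>auto simp: \<delta>_def\<close>)
    then have "B \<le> sqrt (3 * (2 * real r - 1)) * (\<delta> / (r * (real ?n - 1)))"
      unfolding B_def using r by (intro mult_left_mono) auto
    then show ?thesis by (simp add: \<delta>_def mult.commute)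
  qed
  finally show ?thesis by (simp add: N_def)
qed

section \<open>The three bounds as powers of 2\<close>

theorem theorem2p1:
  fixes n d :: nat
  defines "n \<equiv> CARD('n::finite)" and "d \<equiv> CARD('d::finite)"
  shows "(n = 2 \<and> d \<ge> 3 \<longrightarrow>
            margin (Omega :: (real ^ 'n ^ 'd) set) \<le> 2 powr (- (real d / 2) + 1))
       \<and> (n \<ge> 3 \<and> d = 3 \<longrightarrow>
            margin (Omega :: (real ^ 'n ^ 'd) set) \<le> 2 powr (- real n + 1))
       \<and> (\<forall>r::nat. n \<ge> 3 \<and> r \<ge> 2 \<and> d = 6 * r - 3 \<longrightarrow>
            margin (Omega :: (real ^ 'n ^ 'd) set)
              \<le> sqrt 6 / ((real n - 1) * sqrt (real r)) * 2 powr (- (real r * (real n - 1)) + 1)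
          \<and> sqrt 6 / ((real n - 1) * sqrt (real r)) * 2 powr (- (real r * (real n - 1)) + 1)
              \<le> 2 powr (- (real r * (real n - 1)) + 1)
          \<and> 2 powr (- (real r * (real n - 1)) + 1)
              = 2 powr (- ((real d + 3) * (real n - 1) / 6) + 1))"
proof (intro conjI impI allI; (elim conjE)?)
  assume "n = 2" and "d \<ge> 3"
  \<comment> \<open>The parity of \<open>d\<close> decides \<open>e\<close>; for e = 1 and e = 2
    alike, sqrt (2/e) = 2^(1 - e/2), so both cases give 2^(1 - d/2).\<close>
  define e where "e = (if odd d then 1 else 2 :: nat)"
  define m where "m = (d - e) div 2"
  have d: "d = 2 * m + e" using \<open>d \<ge> 3\<close> by (auto simp: m_def e_def elim!: oddE evenE)
  moreover have "e \<le> 2" by (simp add: e_def)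
  ultimately have "m \<ge> 1" using \<open>d \<ge> 3\<close> by linarith
  then have "margin (Omega :: (real ^ 'n ^ 'd) set) \<le> sqrt (2 / e) / 2 ^ m"
    using \<open>n = 2\<close> d by (intro margin_Omega_binary) (auto simp: n_def d_def e_def)
  also have "\<dots> = 2 powr (- (real d / 2) + 1)"
  proof -
    have "sqrt (2 / e) = 2 powr (1 - e / 2)"
      by (simp add: e_def powr_half_sqrt)
    then have "sqrt (2 / e) / 2 ^ m = 2 powr (1 - e / 2) / 2 powr m"
      by (simp add: powr_realpow)
    also have "\<dots> = 2 powr (1 - e / 2 - m)" by (simp add: powr_diff)
    finally show ?thesis by (simp add: d add_divide_distrib algebra_simps)
  qed
  finally show "margin (Omega :: (real ^ 'n ^ 'd) set) \<le> 2 powr (- (real d / 2) + 1)" .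
next
  assume "n \<ge> 3" and "d = 3"
  then have "margin (Omega :: (real ^ 'n ^ 'd) set) \<le> sqrt 3 / (real n - 1) * (1 / 2 ^ (n - 1))"
    using margin_Omega_chain[where 'n = 'n and 'd = 'd and r = 1] by (simp add: n_def d_def)
  also have "\<dots> \<le> 1 * (1 / 2 ^ (n - 1))"
  proof (rule mult_right_mono)
    have "sqrt 3 \<le> 2" by (rule real_le_lsqrt) auto
    then show "sqrt 3 / (real n - 1) \<le> 1" using \<open>n \<ge> 3\<close> by simp
  qed simp
  also have "\<dots> = 2 powr - real (n - 1)"
    by (simp add: powr_minus powr_realpow inverse_eq_divide)
  also have "\<dots> = 2 powr (- real n + 1)" using \<open>n \<ge> 3\<close> by (simp add: of_nat_diff)
  finally show "margin (Omega :: (real ^ 'n ^ 'd) set) \<le> 2 powr (- real n + 1)" .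
next
  fix r :: nat
  assume n3: "n \<ge> 3" and r: "r \<ge> 2" and d: "d = 6 * r - 3"
  let ?b = "2 powr (- (real r * (real n - 1)) + 1)"
  have "margin (Omega :: (real ^ 'n ^ 'd) set)
      \<le> sqrt (3 * (2 * real r - 1)) / (r * (real n - 1)) / 2 ^ (r * n - 1)"
    using margin_Omega_chain[where 'n = 'n and 'd = 'd and r = r] n3 r d by (simp add: n_def d_def)
  also have "\<dots> \<le> sqrt (6 * r) / (r * (real n - 1)) / 2 ^ (r * n - 1)"
    using n3 by (intro divide_right_mono) auto
  also have "\<dots> = sqrt 6 / ((real n - 1) * sqrt r) * (1 / 2 ^ (r * n - 1))"
  proof -
    have cancel: "a * s / (s * s * b) = a / (b * s)" if "s \<noteq> 0" for a b s :: real
      using that by simp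
    have "sqrt (6 * r) / (r * (real n - 1)) = sqrt 6 * sqrt r / (sqrt r * sqrt r * (real n - 1))"
      by (simp add: real_sqrt_mult)
    also have "\<dots> = sqrt 6 / ((real n - 1) * sqrt r)" using r by (intro cancel) simp
    finally show ?thesis by simp
  qed
  also have "\<dots> \<le> sqrt 6 / ((real n - 1) * sqrt r) * ?b"
  proof (rule mult_left_mono)
    have "r * n \<ge> 1" using n3 r by simp
    have "1 / 2 ^ (r * n - 1) = 2 powr - real (r * n - 1)"
      by (simp only: powr_minus powr_realpow inverse_eq_divide zero_less_numeral)
    \<comment> \<open>The exponent 1 - rn is enlarged by \<open>r\<close>.\<close>
    also have "\<dots> \<le> ?b"
      using \<open>r * n \<ge> 1\<close> by (simp add: of_nat_diff algebra_simps)
    finally show "1 / 2 ^ (r * n - 1) \<le> ?b" .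
  qed (use n3 in simp)
  finally show "margin (Omega :: (real ^ 'n ^ 'd) set) \<le> sqrt 6 / ((real n - 1) * sqrt r) * ?b" .
  \<comment> \<open>Here n - 1 \<ge> 2 and r \<ge> 2, so sqrt 8 is a lower bound for the
    denominator.\<close>
  have "sqrt 6 \<le> 2 * sqrt 2" by (rule real_le_lsqrt) (auto simp: power_mult_distrib)
  also have "\<dots> \<le> (real n - 1) * sqrt r" using n3 r by (intro mult_mono) auto
  finally have "sqrt 6 / ((real n - 1) * sqrt r) \<le> 1" using n3 r by simp
  then have "sqrt 6 / ((real n - 1) * sqrt r) * ?b \<le> 1 * ?b" by (rule mult_right_mono) simp
  then show "sqrt 6 / ((real n - 1) * sqrt r) * ?b \<le> ?b" by (simp only: mult_1)
  have "(real d + 3) * (real n - 1) / 6 = real r * (real n - 1)"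
    using d r by (simp add: of_nat_diff)
  then show "?b = 2 powr (- ((real d + 3) * (real n - 1) / 6) + 1)" by (simp only:)
qed

end
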